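(* Let $\Omega\subset\mathbb{R}^n$ be open, let $\phi(\varepsilon)$ be a positive function of $\varepsilon>0$ with $$\lim_{\varepsilon\to0}\phi(\varepsilon)=+\infty\qquad\text{and}\qquad \lim_{\varepsilon\to0}\varepsilon\,\phi(\varepsilon)=0,$$ let $\mathcal{A}\subset S^n_+(\mathbb{R})$, and let $F:S^n(\mathbb{R})\to\mathbb{R}\cup\{-\infty\}$ be the operator $$F(M)=\inf_{A\in\mathcal{A}}\operatorname{trace}(A^tMA).$$ Let $\Gamma_{\mathcal{A}}=\{M\in S^n(\mathbb{R}):F(M)>-\infty\}$ and assume that $F$ is lower semi-continuous in $\Gamma_{\mathcal{A}}\setminus\Gamma_{\mathcal{A}}^\circ$. Let $u\in C^2(\Omega)$ be $\mathcal{A}$-admissible, i.e. $D^2u(x)\in\Gamma_{\mathcal{A}}$ for every $x\in\Omega$. Then, for every $x\in\Omega$, $$F(D^2u(x))=2(n+2)\inf_{\substack{A\in\mathcal{A}\\ A\le\phi(\varepsilon)I}}\ \frac{1}{|B_\varepsilon(0)|}\int_{B_\varepsilon(0)}\frac{u(x+Ay)-u(x)}{\varepsilon^2}\,dy+o(1)\qquad\text{as }\varepsilon\to0.$$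
   Context: $S^n(\mathbb{R})$ is the set of real symmetric $n\times n$ matrices and $S^n_+(\mathbb{R})$ the subset of positive semi-definite ones. $A\le\phi(\varepsilon)I$ is the usual order of symmetric matrices ($\phi(\varepsilon)I-A$ is positive semi-definite). $\Gamma_{\mathcal{A}}^\circ$ is the interior of $\Gamma_{\mathcal{A}}$ in $S^n(\mathbb{R})$. The lower semi-continuity hypothesis is understood for $F$ restricted to $\Gamma_{\mathcal{A}}$ (relative to $\Gamma_{\mathcal{A}}$), at each point of $\Gamma_{\mathcal{A}}\setminus\Gamma_{\mathcal{A}}^\circ$; since $F$ is upper semi-continuous and is continuous in $\Gamma_{\mathcal{A}}^\circ$, it amounts to $F|_{\Gamma_{\mathcal{A}}}$ being continuous. $B_\varepsilon(0)$ is the Euclidean ball in $\mathbb{R}^n$. The integrals are well defined for $\varepsilon$ small, since $|Ay|\le\varepsilon\phi(\varepsilon)\to0$. *)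

theory Defs
  imports "HOL-Analysis.Analysis" "HOL-Library.Landau_Symbols"
begin

definition sym_matrices :: "(real^'n^'n) set" where
  "sym_matrices = {M. transpose M = M}"

definition psd_matrices :: "(real^'n^'n) set" where
  "psd_matrices = {M \<in> sym_matrices. \<forall>v. 0 \<le> v \<bullet> (M *v v)}"

definition loewner_le :: "real^'n^'n \<Rightarrow> real^'n^'n \<Rightarrow> bool" where
  "loewner_le A B \<longleftrightarrow> B - A \<in> psd_matrices"

definition trace_inf_op :: "(real^'n^'n) set \<Rightarrow> real^'n^'n \<Rightarrow> ereal" where
  "trace_inf_op \<A> M = (INF A\<in>\<A>. ereal (trace (transpose A ** M ** A)))"

definition Gamma_set :: "(real^'n^'n) set \<Rightarrow> (real^'n^'n) set" where
  "Gamma_set \<A> = {M \<in> sym_matrices. trace_inf_op \<A> M > -\<infinity>}"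

definition lower_semicontinuous_at_within ::
    "'a::topological_space \<Rightarrow> 'a set \<Rightarrow> ('a \<Rightarrow> ereal) \<Rightarrow> bool" where
  "lower_semicontinuous_at_within x S f \<longleftrightarrow>
     (\<forall>c < f x. \<forall>\<^sub>F y in at x within S. c < f y)"

text \<open>The value is the usual partial derivative at every point where \<open>f\<close> is differentiable,
  which is the only case in which it is used below.\<close>

definition partial_deriv :: "'n::finite \<Rightarrow> (real^'n \<Rightarrow> real) \<Rightarrow> real^'n \<Rightarrow> real" where
  "partial_deriv i f x = frechet_derivative f (at x) (axis i 1)"

definition hessian :: "(real^'n \<Rightarrow> real) \<Rightarrow> real^'n \<Rightarrow> real^'n^'n" where
  "hessian u x = (\<chi> i j. partial_deriv i (partial_deriv j u) x)"

text \<open>Twice continuously differentiable on an open set. Continuity of \<open>u\<close> and of its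
  first partial derivatives follows from their differentiability.\<close>

definition C2_on :: "(real^'n) set \<Rightarrow> (real^'n \<Rightarrow> real) \<Rightarrow> bool" where
  "C2_on \<Omega> u \<longleftrightarrow>
     (\<forall>x\<in>\<Omega>. u differentiable (at x)) \<and>
     (\<forall>j. \<forall>x\<in>\<Omega>. partial_deriv j u differentiable (at x)) \<and>
     (\<forall>i j. continuous_on \<Omega> (partial_deriv i (partial_deriv j u)))"

definition admissible :: "(real^'n^'n) set \<Rightarrow> (real^'n) set \<Rightarrow> (real^'n \<Rightarrow> real) \<Rightarrow> bool" where
  "admissible \<A> \<Omega> u \<longleftrightarrow> (\<forall>x\<in>\<Omega>. hessian u x \<in> Gamma_set \<A>)"

definition ball_mean :: "(real^'n \<Rightarrow> real) \<Rightarrow> real^'n \<Rightarrow> real \<Rightarrow> real^'n^'n \<Rightarrow> real" where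
  "ball_mean u x \<epsilon> A =
     1 / measure lborel (ball (0::real^'n) \<epsilon>) *
     (LINT y:ball 0 \<epsilon>|lborel. (u (x + A *v y) - u x) / \<epsilon>\<^sup>2)"

end

theory Submission
  imports Defs
begin

text \<open>
  For \<open>v(y) = u(x + Ay)\<close> the Laplacian of \<open>v\<close> at \<open>y\<close> is the trace of \<open>A\<^sup>t D\<^sup>2u(x + Ay) A\<close>, which is at
  least \<open>F(D\<^sup>2u(x + Ay))\<close>. As \<open>|Ay| \<le> \<epsilon> \<phi>(\<epsilon>) \<rightarrow> 0\<close>, lower semicontinuity of \<open>F\<close> bounds this from below by
  \<open>F(D\<^sup>2u(x)) - \<delta>\<close>, uniformly in \<open>A\<close>, and the mean value inequality for functions with
  \<open>\<Delta>v \<ge> c\<close> gives the lower bound of the infimum. For the upper bound, a single almost optimal \<open>A\<close> is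
  admissible once \<open>\<phi>(\<epsilon>)\<close> is large, and the same inequality is applied to \<open>-v\<close>.

  The mean value inequality on the ball \<open>B\<close> of radius \<open>R\<close> needs no surface measure: the derivative in
  \<open>r\<close> of \<open>\<integral>\<^sub>B v(ry) dy\<close> is \<open>\<integral>\<^sub>B \<nabla>v(ry) \<bullet> y dy\<close>, and since \<open>-y\<close> is the gradient of the weight
  \<open>(R\<^sup>2 - |y|\<^sup>2) / 2\<close>, which vanishes on the sphere, this equals
  \<open>r \<integral>\<^sub>B \<Delta>v(ry) (R\<^sup>2 - |y|\<^sup>2) / 2 dy\<close>.
\<close>

section \<open>Integration by parts on a ball\<close>

text \<open>By translation invariance of Lebesgue measure every difference quotient of
  \<open>f\<close> in direction \<open>b\<close> has integral zero. The Lipschitz bound with bounded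
  support dominates the quotients along \<open>h n\<close>, so dominated convergence carries the
  value zero over to \<open>D\<close>.\<close>

lemma integral_directional_derivative_eq_0:
  fixes f D :: "'a::euclidean_space \<Rightarrow> real"
  assumes int: "integrable lborel f"
    and D: "D \<in> borel_measurable lborel"
    and "d > 0"
    and bound: "\<And>h y. 0 < h \<Longrightarrow> h \<le> d \<Longrightarrow> \<bar>f (y + h *\<^sub>R b) - f y\<bar> \<le> C * h * indicator (cball 0 K) y"
    and deriv: "AE y in lborel. ((\<lambda>h. f (y + h *\<^sub>R b)) has_real_derivative D y) (at 0)"
  shows "integral\<^sup>L lborel D = 0"
proof -
  define h where "h n = d / real (Suc n)" for n
  have h: "0 < h n" "h n \<le> d" for n
    using \<open>d > 0\<close> by (auto simp: h_def field_simps)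
  have h_lim: "h \<longlonglongrightarrow> 0"
    unfolding h_def using LIMSEQ_Suc[OF lim_const_over_n[of d]] by simp
  have fm [measurable]: "f \<in> borel_measurable borel"
    using borel_measurable_integrable[OF int] by simp
  have shift: "integrable lborel (\<lambda>y. f (y + c))"
    "(LINT y|lborel. f (y + c)) = integral\<^sup>L lborel f" for c
  proof -
    have *: "distr lborel borel ((+) c) = (lborel :: 'a measure)" by (rule lborel_distr_plus)
    show "integrable lborel (\<lambda>y. f (y + c))"
      using integrable_distr_eq[of "(+) c" lborel borel f] int by (simp add: * add.commute)
    show "(LINT y|lborel. f (y + c)) = integral\<^sup>L lborel f"
      using integral_distr[of "(+) c" lborel borel f] by (simp add: * add.commute)
  qed
  have "(\<lambda>n. LINT y|lborel. (f (y + h n *\<^sub>R b) - f y) / h n) \<longlonglongrightarrow> integral\<^sup>L lborel D"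
  proof (rule integral_dominated_convergence[where w = "\<lambda>y. C * indicator (cball 0 K) y"])
    show "integrable lborel (\<lambda>y::'a. C * indicator (cball 0 K) y)"
      using emeasure_lborel_cball_finite[of "0::'a" K] by (auto intro!: integrable_mult_right integrable_real_indicator)
    show "AE y in lborel. (\<lambda>n. (f (y + h n *\<^sub>R b) - f y) / h n) \<longlonglongrightarrow> D y"
      using deriv
    proof eventually_elim
      case (elim y)
      have "((\<lambda>t. (f (y + t *\<^sub>R b) - f y) / t) \<longlongrightarrow> D y) (at 0)"
        using elim by (simp add: has_field_derivative_iff)
      moreover have "filterlim h (at 0) sequentially"
        using h_lim h(1) by (auto simp: filterlim_at intro!: always_eventually less_imp_neq[symmetric])
      ultimately show ?case by (rule filterlim_compose)
    qed
    show "AE y in lborel. norm ((f (y + h n *\<^sub>R b) - f y) / h n) \<le> C * indicator (cball 0 K) y" for n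
      using bound[OF h(1,2)] h(1)[of n] by (auto simp: field_simps intro!: always_eventually)
  qed (use D in measurable)
  moreover have "(LINT y|lborel. (f (y + h n *\<^sub>R b) - f y) / h n) = 0" for n
    using shift int by (simp add: Bochner_Integration.integral_diff)
  ultimately have "(\<lambda>n::nat. 0) \<longlonglongrightarrow> integral\<^sup>L lborel D"
    by (simp only:)
  then show ?thesis
    by (simp add: LIMSEQ_const_iff)
qed

lemma norm_add_scaleR_sq_diff:
  fixes y b :: "'a::real_inner"
  shows "(norm (y + h *\<^sub>R b))\<^sup>2 - (norm y)\<^sup>2 = h * (2 * (y \<bullet> b) + h * (norm b)\<^sup>2)"
  unfolding power2_norm_eq_inner by (simp add: inner_simps inner_commute[of b y] algebra_simps)

lemma AE_lborel_not_in_sphere: "AE y in lborel. y \<notin> sphere c r"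
  for c :: "'a::euclidean_space"
  using negligible_sphere[of c r]
  by (intro AE_not_in) (simp add: negligible_iff_null_sets null_sets_completion_iff)

text \<open>The weight vanishes on the sphere, so its product with \<open>g\<close>, extended by zero, is Lipschitz and
  no boundary term appears.\<close>

lemma integral_cball_by_parts:
  fixes g :: "'a::euclidean_space \<Rightarrow> real"
  assumes "open S" "cball 0 R \<subseteq> S" "R > 0"
    and g: "\<And>y. y \<in> S \<Longrightarrow> (g has_derivative g' y) (at y)"
    and cont: "continuous_on S (\<lambda>y. g' y b)"
  shows "(LINT y:cball 0 R|lborel. g' y b * ((R\<^sup>2 - (norm y)\<^sup>2) / 2)) =
         (LINT y:cball 0 R|lborel. g y * (y \<bullet> b))"
proof -
  have max_lip: "\<bar>max 0 p - max 0 q\<bar> \<le> \<bar>p - q\<bar>" for p q :: real by (simp add: max_def)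
  have gcont: "continuous_on S g"
    using g by (meson continuous_at_imp_continuous_on has_derivative_continuous)
  \<comment> \<open>Compactness leaves a margin \<delta> around the ball, so that \<open>g\<close>
    and its derivative are bounded on the larger ball \<open>K\<close> and short translates of
    \<open>y\<close> can be compared there.\<close>
  obtain \<delta> where \<delta>: "\<delta> > 0" "(\<Union>x\<in>cball 0 R. cball x \<delta>) \<subseteq> S"
    using compact_subset_open_imp_cball_epsilon_subset[OF compact_cball \<open>open S\<close> \<open>cball 0 R \<subseteq> S\<close>] by blast
  define K where "K = cball (0::'a) (R + \<delta>)"
  have "K \<subseteq> S"
  proof
    fix y assume y: "y \<in> K"
    show "y \<in> S"
    proof (cases "norm y \<le> R")
      case True
      then show ?thesis using \<open>cball 0 R \<subseteq> S\<close> by auto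
    next
      \<comment> \<open>A point outside the ball is compared with its radial projection onto the
        sphere, which lies at distance \<open>norm y - R\<close>.\<close>
      case False
      then have "norm y > 0" using \<open>R > 0\<close> by linarith
      have "dist ((R / norm y) *\<^sub>R y) y = \<bar>R / norm y - 1\<bar> * norm y"
        by (metis dist_norm norm_scaleR scaleR_left_diff_distrib scaleR_one)
      also have "\<dots> = norm y - R"
        using False \<open>norm y > 0\<close> by (simp add: abs_if field_simps)
      finally have "y \<in> cball ((R / norm y) *\<^sub>R y) \<delta>" using y by (simp add: K_def)
      moreover have "(R / norm y) *\<^sub>R y \<in> cball 0 R" using \<open>norm y > 0\<close> \<open>R > 0\<close> by simp
      ultimately show ?thesis using \<delta>(2) by blast
    qed
  qed
  have "bounded (g ` K)" "bounded ((\<lambda>y. g' y b) ` K)"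
    using gcont cont \<open>K \<subseteq> S\<close> unfolding K_def
    by (meson compact_cball compact_continuous_image compact_imp_bounded continuous_on_subset)+
  then obtain Cg Cd where Cg: "\<And>y. y \<in> K \<Longrightarrow> \<bar>g y\<bar> \<le> Cg" and Cd: "\<And>y. y \<in> K \<Longrightarrow> \<bar>g' y b\<bar> \<le> Cd"
    unfolding bounded_iff by fastforce
  \<comment> \<open>Truncation at zero extends the weight to the whole space without losing the
    Lipschitz property. \<open>D\<close> is the derivative of \<open>f\<close> in direction
    \<open>b\<close> off the sphere; its values on the sphere do not matter, a null set being
    allowed.\<close>
  define w where "w y = max 0 ((R\<^sup>2 - (norm y)\<^sup>2) / 2)" for y :: 'a
  define f where "f y = g y * w y" for y
  define D where "D y = indicator (cball 0 R) y *\<^sub>R (g' y b * ((R\<^sup>2 - (norm y)\<^sup>2) / 2) - g y * (y \<bullet> b))" for y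
  have w_in: "w y = (R\<^sup>2 - (norm y)\<^sup>2) / 2" if "norm y \<le> R" for y
    using that by (simp add: w_def power_mono)
  have w_out: "w y = 0" if "norm y \<ge> R" for y
    using that \<open>R > 0\<close> by (simp add: w_def power_mono)
  have w_bound: "\<bar>w y\<bar> \<le> R\<^sup>2" for y by (auto simp: w_def max_def)
  have f_eq: "f = (\<lambda>y. indicator (cball 0 R) y *\<^sub>R (g y * ((R\<^sup>2 - (norm y)\<^sup>2) / 2)))"
    using w_in w_out by (auto simp: f_def fun_eq_iff indicator_def)
  have contR: "continuous_on (cball 0 R) g" "continuous_on (cball 0 R) (\<lambda>y. g' y b)"
    using gcont cont \<open>cball 0 R \<subseteq> S\<close> by (auto intro: continuous_on_subset)
  have int1: "integrable lborel (\<lambda>y. indicator (cball 0 R) y *\<^sub>R (g' y b * ((R\<^sup>2 - (norm y)\<^sup>2) / 2)))"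
   and int2: "integrable lborel (\<lambda>y. indicator (cball 0 R) y *\<^sub>R (g y * (y \<bullet> b)))"
    by (intro borel_integrable_compact compact_cball continuous_intros contR; simp)+
  \<comment> \<open>This choice gives \<open>h * norm b \<le> \<delta>\<close> whenever
    \<open>h \<le> d\<close>; the added 1 keeps the denominator positive when \<open>b\<close> is
    zero.\<close>
  define d where "d = \<delta> / (norm b + 1)"
  have "integral\<^sup>L lborel D = 0"
  proof (rule integral_directional_derivative_eq_0[where f = f and d = d and b = b and K = "R + \<delta>"
         and C = "Cg * (norm b * (R + 2 * \<delta>)) + Cd * R\<^sup>2"])
    show "integrable lborel f"
      unfolding f_eq by (intro borel_integrable_compact compact_cball continuous_intros contR) simp
    show "D \<in> borel_measurable lborel"
      unfolding D_def[abs_def] scaleR_diff_right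
      by (rule borel_measurable_diff[OF borel_measurable_integrable[OF int1] borel_measurable_integrable[OF int2]])
    show "d > 0" using \<delta> by (simp add: d_def add_nonneg_pos)
  next
    fix h :: real and y :: 'a assume h: "0 < h" "h \<le> d"
    let ?z = "y + h *\<^sub>R b"
    have hb: "h * norm b \<le> \<delta>"
    proof -
      have "h * (norm b + 1) \<le> \<delta>" using h(2) by (simp add: d_def pos_le_divide_eq add_nonneg_pos)
      then show ?thesis using h(1) by (simp add: algebra_simps)
    qed
    have dist: "norm (h *\<^sub>R b) \<le> \<delta>" using hb h by simp
    show "\<bar>f ?z - f y\<bar> \<le> (Cg * (norm b * (R + 2 * \<delta>)) + Cd * R\<^sup>2) * h * indicator (cball 0 (R + \<delta>)) y"
    proof (cases "y \<in> K \<and> ?z \<in> K")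
      case True
      then have yK: "y \<in> K" and zK: "?z \<in> K" by auto
      have seg: "y + t *\<^sub>R b \<in> K" if "0 \<le> t" "t \<le> h" for t
      proof -
        have "(1 - t / h) *\<^sub>R y + (t / h) *\<^sub>R ?z \<in> K"
          using that h yK zK unfolding K_def by (intro convexD[OF convex_cball]) auto
        also have "(1 - t / h) *\<^sub>R y + (t / h) *\<^sub>R ?z = y + t *\<^sub>R b"
          using h(1) by (simp add: algebra_simps)
        finally show ?thesis .
      qed
      have "\<exists>t\<in>{0<..<h}. g (y + h *\<^sub>R b) - g (y + 0 *\<^sub>R b) = (\<lambda>s. g' (y + t *\<^sub>R b) (s *\<^sub>R b)) (h - 0)"
      proof (rule mvt_simple[OF h(1)])
        fix t assume t: "0 \<le> t" "t \<le> h"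
        then have "y + t *\<^sub>R b \<in> S" using seg \<open>K \<subseteq> S\<close> by blast
        show "((\<lambda>t. g (y + t *\<^sub>R b)) has_derivative (\<lambda>s. g' (y + t *\<^sub>R b) (s *\<^sub>R b))) (at t within {0..h})"
          by (rule has_derivative_compose[where f = "\<lambda>t. y + t *\<^sub>R b"])
            (auto intro!: derivative_eq_intros simp: g[OF \<open>y + t *\<^sub>R b \<in> S\<close>])
      qed
      then obtain t where t: "0 < t" "t < h" "g ?z - g y = g' (y + t *\<^sub>R b) (h *\<^sub>R b)" by auto
      have tK: "y + t *\<^sub>R b \<in> K" using seg t by simp
      then have "y + t *\<^sub>R b \<in> S" using \<open>K \<subseteq> S\<close> by blast
      have gd: "g ?z - g y = h * g' (y + t *\<^sub>R b) b"
        using t(3) linear_scale[OF has_derivative_linear[OF g[OF \<open>y + t *\<^sub>R b \<in> S\<close>]]] by simp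
      have "\<bar>g ?z - g y\<bar> \<le> Cd * h"
        using Cd[OF tK] h(1) by (simp add: gd abs_mult)
      moreover have "\<bar>w ?z - w y\<bar> \<le> (norm b * (R + 2 * \<delta>)) * h"
      proof -
        have "\<bar>w ?z - w y\<bar> \<le> \<bar>(norm ?z)\<^sup>2 - (norm y)\<^sup>2\<bar> / 2"
        proof -
          have "(R\<^sup>2 - (norm ?z)\<^sup>2) / 2 - (R\<^sup>2 - (norm y)\<^sup>2) / 2 = - (((norm ?z)\<^sup>2 - (norm y)\<^sup>2) / 2)"
            by (simp add: field_simps)
          then have "\<bar>w ?z - w y\<bar> \<le> \<bar>- (((norm ?z)\<^sup>2 - (norm y)\<^sup>2) / 2)\<bar>"
            using max_lip unfolding w_def by metis
          then show ?thesis by (simp only: abs_minus_cancel abs_divide abs_numeral)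
        qed
        also have "(norm ?z)\<^sup>2 - (norm y)\<^sup>2 = h * (2 * (y \<bullet> b) + h * (norm b)\<^sup>2)"
          by (rule norm_add_scaleR_sq_diff)
        \<comment> \<open>The part \<open>R + \<delta>\<close> bounds the norm of \<open>y\<close>
          in \<open>K\<close>; the other \<delta> absorbs the term quadratic in
          \<open>h\<close>.\<close>
        also have "\<bar>h * (2 * (y \<bullet> b) + h * (norm b)\<^sup>2)\<bar> / 2 \<le> h * (norm b * (R + 2 * \<delta>))"
        proof -
          have "\<bar>y \<bullet> b\<bar> \<le> (R + \<delta>) * norm b"
            using Cauchy_Schwarz_ineq2[of y b] yK mult_right_mono[of "norm y" "R + \<delta>" "norm b"]
            by (simp add: K_def)
          moreover have "h * (norm b)\<^sup>2 \<le> \<delta> * norm b"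
            using mult_right_mono[OF hb, of "norm b"] by (simp add: power2_eq_square mult.assoc)
          moreover have "0 \<le> \<delta> * norm b" "0 \<le> h * (norm b)\<^sup>2" using \<delta> h by auto
          ultimately have "\<bar>2 * (y \<bullet> b) + h * (norm b)\<^sup>2\<bar> \<le> 2 * (norm b * (R + 2 * \<delta>))"
            by (simp add: algebra_simps abs_le_iff)
          from mult_left_mono[OF this, of h] show ?thesis
            using h(1) abs_mult[of h "2 * (y \<bullet> b) + h * (norm b)\<^sup>2"] by linarith
        qed
        finally show ?thesis by (simp add: mult.commute)
      qed
      \<comment> \<open>Product splitting: each summand pairs the increment of one factor with a
        bound on the other.\<close>
      moreover have "f ?z - f y = g ?z * (w ?z - w y) + (g ?z - g y) * w y"
        by (simp add: f_def algebra_simps)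
      moreover have "\<bar>g ?z * (w ?z - w y)\<bar> \<le> Cg * ((norm b * (R + 2 * \<delta>)) * h)"
        unfolding abs_mult using calculation(2) Cg[OF zK] by (intro mult_mono) auto
      moreover have "\<bar>(g ?z - g y) * w y\<bar> \<le> (Cd * h) * R\<^sup>2"
        unfolding abs_mult using calculation(1) w_bound[of y] by (intro mult_mono) auto
      ultimately have "\<bar>f ?z - f y\<bar> \<le> Cg * ((norm b * (R + 2 * \<delta>)) * h) + (Cd * h) * R\<^sup>2"
        by linarith
      then show ?thesis using yK by (simp add: K_def algebra_simps)
    next
      \<comment> \<open>One endpoint lies outside \<open>K\<close> and the translation has length at
        most \<delta>, so neither endpoint is inside the open ball and \<open>f\<close> vanishes at
        both.\<close>
      case False
      have "norm y \<ge> R" "norm ?z \<ge> R"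
        using False dist norm_triangle_ineq[of y "h *\<^sub>R b"] norm_triangle_ineq4[of ?z "h *\<^sub>R b"] \<delta>(1)
        by (auto simp: K_def)
      moreover have "0 \<le> Cg" "0 \<le> Cd"
        using Cg[of 0] Cd[of 0] \<open>R > 0\<close> \<delta>(1) by (auto simp: K_def)
      ultimately show ?thesis using h \<delta>(1) \<open>R > 0\<close> by (simp add: f_def w_out)
    qed
  next
    show "AE y in lborel. ((\<lambda>h. f (y + h *\<^sub>R b)) has_real_derivative D y) (at 0)"
      using AE_lborel_not_in_sphere[of "0::'a" R]
    proof eventually_elim
      case (elim y)
      have lim: "((\<lambda>h. norm (y + h *\<^sub>R b)) \<longlongrightarrow> norm y) (nhds 0)"
        using tendsto_norm[OF tendsto_add[OF tendsto_const[of y] tendsto_scaleR[OF filterlim_ident tendsto_const[of b]]], of "0::real"]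
        by simp
      consider "norm y < R" | "norm y > R" using elim by fastforce
      then show ?case
      proof cases
        case 1
        then have "y \<in> S" using \<open>cball 0 R \<subseteq> S\<close> by auto
        have ev: "\<forall>\<^sub>F h in nhds 0. g (y + h *\<^sub>R b) * ((R\<^sup>2 - (norm (y + h *\<^sub>R b))\<^sup>2) / 2) = f (y + h *\<^sub>R b)"
          using order_tendstoD(2)[OF lim 1] by eventually_elim (simp add: f_def w_in)
        have gd: "((\<lambda>h. g (y + h *\<^sub>R b)) has_real_derivative g' y b) (at 0)"
        proof -
          have "((\<lambda>h. g (y + h *\<^sub>R b)) has_derivative (\<lambda>s. g' y (s *\<^sub>R b))) (at 0)"
            by (rule has_derivative_compose[where f = "\<lambda>h. y + h *\<^sub>R b"])
              (auto intro!: derivative_eq_intros simp: g[OF \<open>y \<in> S\<close>])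
          moreover have "g' y (s *\<^sub>R b) = g' y b * s" for s
            using linear_scale[OF has_derivative_linear[OF g[OF \<open>y \<in> S\<close>]]] by simp
          ultimately show ?thesis by (simp add: has_field_derivative_def)
        qed
        have nd: "((\<lambda>h. (R\<^sup>2 - (norm (y + h *\<^sub>R b))\<^sup>2) / 2) has_real_derivative - (y \<bullet> b)) (at 0)"
        proof -
          have eq: "(\<lambda>h. (R\<^sup>2 - (norm (y + h *\<^sub>R b))\<^sup>2) / 2)
               = (\<lambda>h. (R\<^sup>2 - ((norm y)\<^sup>2 + 2 * h * (y \<bullet> b) + h\<^sup>2 * (norm b)\<^sup>2)) / 2)"
          proof
            fix h
            have "(norm (y + h *\<^sub>R b))\<^sup>2 = (norm y)\<^sup>2 + 2 * h * (y \<bullet> b) + h\<^sup>2 * (norm b)\<^sup>2"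
              using norm_add_scaleR_sq_diff[of y h b] by (simp add: algebra_simps power2_eq_square[of h])
            then show "(R\<^sup>2 - (norm (y + h *\<^sub>R b))\<^sup>2) / 2
               = (R\<^sup>2 - ((norm y)\<^sup>2 + 2 * h * (y \<bullet> b) + h\<^sup>2 * (norm b)\<^sup>2)) / 2" by simp
          qed
          show ?thesis unfolding eq by (auto intro!: derivative_eq_intros)
        qed
        have "D y = g' y b * ((R\<^sup>2 - (norm (y + 0 *\<^sub>R b))\<^sup>2) / 2) + - (y \<bullet> b) * g (y + 0 *\<^sub>R b)"
          using 1 by (simp add: D_def)
        with DERIV_mult[OF gd nd]
        have "((\<lambda>h. g (y + h *\<^sub>R b) * ((R\<^sup>2 - (norm (y + h *\<^sub>R b))\<^sup>2) / 2)) has_real_derivative D y) (at 0)"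
          by simp
        then show ?thesis using DERIV_cong_ev[OF refl ev refl] by blast
      next
        case 2
        have ev: "\<forall>\<^sub>F h in nhds 0. 0 = f (y + h *\<^sub>R b)"
          using order_tendstoD(1)[OF lim 2] by eventually_elim (simp add: f_def w_out)
        have "((\<lambda>h. 0) has_real_derivative D y) (at 0)"
          using 2 by (simp add: D_def)
        then show ?thesis using DERIV_cong_ev[OF refl ev refl] by blast
      qed
    qed
  qed
  moreover have "integral\<^sup>L lborel D =
     (LINT y:cball 0 R|lborel. g' y b * ((R\<^sup>2 - (norm y)\<^sup>2) / 2)) -
     (LINT y:cball 0 R|lborel. g y * (y \<bullet> b))"
    unfolding set_lebesgue_integral_def D_def scaleR_diff_right
    by (rule Bochner_Integration.integral_diff[OF int1 int2])
  ultimately show ?thesis by simp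
qed

section \<open>The mean value inequality under a lower bound on the Laplacian\<close>

text \<open>Integration by parts for \<open>y \<bullet> b\<close> identifies the integral
  \<open>?I\<close> with the second moment of the ball in each basis direction \<open>b\<close>.
  Summing over \<open>b\<close>, the dimension times \<open>?I\<close> is the integral of the
  squared norm, which is also \<open>R^2\<close> times the volume minus \<open>2 * ?I\<close>; this
  is solved for \<open>?I\<close>.\<close>

lemma integral_cball_weight:
  assumes "R > 0"
  shows "(LINT y:cball (0::'a::euclidean_space) R|lborel. (R\<^sup>2 - (norm y)\<^sup>2) / 2) =
         R\<^sup>2 * measure lborel (cball (0::'a) R) / (real DIM('a) + 2)"
    (is "?I = _")
proof -
  have eq: "?I = (LINT y:cball (0::'a) R|lborel. (y \<bullet> b)\<^sup>2)" if "b \<in> Basis" for b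
  proof -
    have "((\<lambda>y. y \<bullet> b) has_derivative (\<lambda>h. h \<bullet> b)) (at y)" for y :: 'a
      by (auto intro!: derivative_eq_intros)
    from integral_cball_by_parts[of UNIV R, OF _ _ \<open>R > 0\<close> this, of b] show ?thesis
      using that by (simp add: inner_Basis power2_eq_square[of "_ \<bullet> _"])
  qed
  have int: "integrable lborel (\<lambda>y. indicator (cball (0::'a) R) y *\<^sub>R f y)"
    if "continuous_on UNIV f" for f :: "'a \<Rightarrow> real"
    using that by (intro borel_integrable_compact compact_cball) (auto intro: continuous_on_subset)
  have "real DIM('a) * ?I = (\<Sum>b\<in>(Basis::'a set). LINT y:cball (0::'a) R|lborel. (y \<bullet> b)\<^sup>2)"
    by (simp only: sum.cong[OF refl eq[symmetric]] sum_constant)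
  also have "\<dots> = (LINT y:cball (0::'a) R|lborel. (\<Sum>b\<in>Basis. (y \<bullet> b)\<^sup>2))"
    unfolding set_lebesgue_integral_def scaleR_sum_right
    by (intro Bochner_Integration.integral_sum[symmetric] int continuous_intros)
  also have "\<dots> = (LINT y:cball (0::'a) R|lborel. (norm y)\<^sup>2)"
  proof -
    have "(\<Sum>b\<in>Basis. (y \<bullet> b)\<^sup>2) = (norm y)\<^sup>2" for y :: 'a
      unfolding power2_norm_eq_inner euclidean_inner[of y y] by (simp add: power2_eq_square)
    then show ?thesis by simp
  qed
  also have "\<dots> = (LINT y:cball (0::'a) R|lborel. R\<^sup>2 - 2 * ((R\<^sup>2 - (norm y)\<^sup>2) / 2))"
    by (simp add: diff_divide_distrib right_diff_distrib)
  also have "\<dots> = (LINT y:cball (0::'a) R|lborel. R\<^sup>2) - (LINT y:cball (0::'a) R|lborel. 2 * ((R\<^sup>2 - (norm y)\<^sup>2) / 2))"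
    unfolding set_lebesgue_integral_def scaleR_diff_right
    by (rule Bochner_Integration.integral_diff; intro int continuous_intros) auto
  also have "\<dots> = R\<^sup>2 * measure lborel (cball (0::'a) R) - 2 * ?I"
    unfolding set_integral_mult_right by (simp add: set_lebesgue_integral_def mult.commute)
  finally show ?thesis by (simp add: field_simps)
qed

text \<open>Here \<open>p b y b\<close> is the second derivative of \<open>v\<close> in direction
  \<open>b\<close>, so the sum over the basis is the Laplacian. The increment
  \<open>v y - v 0\<close> is integrated along the ray from 0 to \<open>y\<close>, and for each
  \<open>r\<close> the integral over the ball is bounded below by parts.\<close>

lemma mean_value_inequality_cball:
  fixes v :: "'a::euclidean_space \<Rightarrow> real"
  assumes "open S" "cball 0 R \<subseteq> S" "R > 0"
    and v: "\<And>y. y \<in> S \<Longrightarrow> (v has_derivative v' y) (at y)"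
    and p: "\<And>b y. b \<in> Basis \<Longrightarrow> y \<in> S \<Longrightarrow> ((\<lambda>z. v' z b) has_derivative p b y) (at y)"
    and cont: "\<And>b. b \<in> Basis \<Longrightarrow> continuous_on S (\<lambda>y. p b y b)"
    and ge: "\<And>y. y \<in> cball 0 R \<Longrightarrow> c \<le> (\<Sum>b\<in>Basis. p b y b)"
  shows "c * (R\<^sup>2 * measure lborel (cball (0::'a) R) / (2 * (real DIM('a) + 2)))
         \<le> (LINT y:cball 0 R|lborel. v y - v 0)"
proof -
  define B where "B = cball (0::'a) R"
  define w where "w y = (R\<^sup>2 - (norm y)\<^sup>2) / 2" for y :: 'a
  \<comment> \<open>The derivative of \<open>v\<close> along the ray at parameter \<open>r\<close>,
    expanded in the basis: this form shows joint continuity in \<open>r\<close> and \<open>y\<close>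
    and lets integration by parts act on one direction at a time.\<close>
  define G where "G r y = (\<Sum>b\<in>Basis. (y \<bullet> b) * v' (r *\<^sub>R y) b)" for r y
  define I where "I = (LINT y:B|lborel. w y)"
  have BS: "r *\<^sub>R y \<in> B" "r *\<^sub>R y \<in> S" if "y \<in> B" "r \<in> {0..1}" for r y
  proof -
    show "r *\<^sub>R y \<in> B"
      using that mult_mono[of r 1 "norm y" R] by (auto simp: B_def)
    then show "r *\<^sub>R y \<in> S"
      using \<open>cball 0 R \<subseteq> S\<close> unfolding B_def by blast
  qed
  have intB: "integrable lborel (\<lambda>y. indicator B y *\<^sub>R f y)" if "continuous_on B f" for f :: "'a \<Rightarrow> real"
    using that unfolding B_def by (intro borel_integrable_compact compact_cball)
  have pcont: "continuous_on S (\<lambda>z. v' z b)" if "b \<in> Basis" for b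
    using p[OF that] by (meson continuous_at_imp_continuous_on has_derivative_continuous)
  have w_nonneg: "0 \<le> w y" if "y \<in> B" for y
    using that by (simp add: w_def B_def power_mono)
  have lin: "linear (v' y)" if "y \<in> S" for y
    using v[OF that] by (rule has_derivative_linear)
  have G_eq: "v' (r *\<^sub>R y) y = G r y" if "y \<in> B" "r \<in> {0..1}" for r y
  proof -
    interpret linear "v' (r *\<^sub>R y)" using lin BS(2)[OF that] by blast
    have "v' (r *\<^sub>R y) y = v' (r *\<^sub>R y) (\<Sum>b\<in>Basis. (y \<bullet> b) *\<^sub>R b)" by (simp add: euclidean_representation)
    also have "\<dots> = G r y" by (simp only: sum scale G_def real_scaleR_def)
    finally show ?thesis .
  qed
  have Gcont: "continuous_on ({0..1} \<times> B) (\<lambda>(r, y). G r y)"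
    unfolding G_def case_prod_beta
    by (intro continuous_intros continuous_on_compose2[OF pcont]) (auto dest: BS(2))
  \<comment> \<open>By parts, the left-out integral of \<open>G r\<close> is \<open>r\<close> times
    the Laplacian at \<open>r *\<^sub>R y\<close> integrated against \<open>w\<close>. As
    \<open>w\<close> is nonnegative on \<open>B\<close>, the lower bound \<open>c\<close> passes
    through.\<close>
  have Gy: "c * I * r \<le> (LINT y:B|lborel. G r y)" if r: "r \<in> {0..1}" for r
  proof -
    \<comment> \<open>Integration by parts is applied to the rescaled function on this preimage. The
      factor \<open>r\<close> then comes from the chain rule, so nothing is divided by
      \<open>r\<close> and \<open>r = 0\<close> is included.\<close>
    define Sr where "Sr = (\<lambda>y. r *\<^sub>R y) -` S"
    have "open Sr"
      unfolding Sr_def by (intro open_vimage \<open>open S\<close> continuous_intros)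
    have BSr: "cball 0 R \<subseteq> Sr"
      using BS(2)[OF _ r] by (auto simp: Sr_def B_def)
    have c1: "continuous_on B (\<lambda>y. (y \<bullet> b) * v' (r *\<^sub>R y) b)" if "b \<in> Basis" for b
      using that by (intro continuous_intros continuous_on_compose2[OF pcont]) (auto dest: BS(2)[OF _ r])
    have c2: "continuous_on B (\<lambda>y. p b (r *\<^sub>R y) b * w y)" if "b \<in> Basis" for b
      unfolding w_def using that
      by (intro continuous_intros continuous_on_compose2[OF cont]) (auto dest: BS(2)[OF _ r])
    have parts: "(LINT y:B|lborel. (y \<bullet> b) * v' (r *\<^sub>R y) b) = r * (LINT y:B|lborel. p b (r *\<^sub>R y) b * w y)"
      if b: "b \<in> Basis" for b
    proof -
      have "(LINT y:cball 0 R|lborel. p b (r *\<^sub>R y) (r *\<^sub>R b) * ((R\<^sup>2 - (norm y)\<^sup>2) / 2)) =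
         (LINT y:cball 0 R|lborel. v' (r *\<^sub>R y) b * (y \<bullet> b))"
      proof (rule integral_cball_by_parts[where g' = "\<lambda>y h. p b (r *\<^sub>R y) (r *\<^sub>R h)", OF \<open>open Sr\<close> BSr \<open>R > 0\<close>])
        fix y assume "y \<in> Sr"
        then have "r *\<^sub>R y \<in> S" by (simp add: Sr_def)
        show "((\<lambda>y. v' (r *\<^sub>R y) b) has_derivative (\<lambda>h. p b (r *\<^sub>R y) (r *\<^sub>R h))) (at y)"
          by (rule has_derivative_compose[where f = "\<lambda>y. r *\<^sub>R y" and g = "\<lambda>z. v' z b"])
            (auto intro!: derivative_eq_intros simp: p[OF b \<open>r *\<^sub>R y \<in> S\<close>])
      next
        have "p b (r *\<^sub>R y) (r *\<^sub>R b) = r * p b (r *\<^sub>R y) b" if "y \<in> Sr" for y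
          using that p[OF b, of "r *\<^sub>R y"] by (simp add: Sr_def linear_scale[OF has_derivative_linear])
        moreover have "continuous_on Sr (\<lambda>y. r * p b (r *\<^sub>R y) b)"
          by (intro continuous_intros continuous_on_compose2[OF cont[OF b]]) (auto simp: Sr_def)
        ultimately show "continuous_on Sr (\<lambda>y. p b (r *\<^sub>R y) (r *\<^sub>R b))"
          by simp
      qed
      also have "(LINT y:cball 0 R|lborel. p b (r *\<^sub>R y) (r *\<^sub>R b) * ((R\<^sup>2 - (norm y)\<^sup>2) / 2)) =
          (LINT y:cball 0 R|lborel. r * (p b (r *\<^sub>R y) b * w y))"
      proof (rule set_lebesgue_integral_cong; safe?)
        fix y :: 'a assume "y \<in> cball 0 R"
        then have "r *\<^sub>R y \<in> S" using BS(2)[OF _ r] by (simp add: B_def)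
        then show "p b (r *\<^sub>R y) (r *\<^sub>R b) * ((R\<^sup>2 - (norm y)\<^sup>2) / 2) = r * (p b (r *\<^sub>R y) b * w y)"
          using p[OF b, of "r *\<^sub>R y"] by (simp add: w_def linear_scale[OF has_derivative_linear])
      qed simp
      finally show ?thesis
        by (simp add: B_def set_integral_mult_right mult.commute)
    qed
    have "(LINT y:B|lborel. G r y) = (\<Sum>b\<in>Basis. LINT y:B|lborel. (y \<bullet> b) * v' (r *\<^sub>R y) b)"
      unfolding set_lebesgue_integral_def G_def scaleR_sum_right
      by (intro Bochner_Integration.integral_sum intB c1)
    also have "\<dots> = r * (\<Sum>b\<in>Basis. LINT y:B|lborel. p b (r *\<^sub>R y) b * w y)"
      using parts by (simp add: sum_distrib_left)
    also have "(\<Sum>b\<in>Basis. LINT y:B|lborel. p b (r *\<^sub>R y) b * w y)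
        = (LINT y:B|lborel. (\<Sum>b\<in>Basis. p b (r *\<^sub>R y) b * w y))"
      unfolding set_lebesgue_integral_def scaleR_sum_right
      by (intro Bochner_Integration.integral_sum[symmetric] intB c2)
    also have "r * \<dots> \<ge> r * (LINT y:B|lborel. c * w y)"
    proof (intro mult_left_mono set_integral_mono)
      show "set_integrable lborel B (\<lambda>y. c * w y)"
        unfolding set_integrable_def w_def by (intro intB continuous_intros) simp
      show "set_integrable lborel B (\<lambda>y. \<Sum>b\<in>Basis. p b (r *\<^sub>R y) b * w y)"
        unfolding set_integrable_def by (intro intB continuous_on_sum c2)
    next
      fix y assume y: "y \<in> B"
      have "c * w y \<le> (\<Sum>b\<in>Basis. p b (r *\<^sub>R y) b) * w y"
        using ge[of "r *\<^sub>R y"] BS(1)[OF y r] w_nonneg[OF y] by (intro mult_right_mono) (auto simp: B_def)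
      then show "c * w y \<le> (\<Sum>b\<in>Basis. p b (r *\<^sub>R y) b * w y)" by (simp add: sum_distrib_right)
    qed (use r in auto)
    finally show ?thesis by (simp add: I_def set_integral_mult_right mult_ac)
  qed
  \<comment> \<open>Continuity on a compact product gives the joint integrability that Fubini
    requires.\<close>
  have "integrable lborel (\<lambda>z. indicator ({0..1} \<times> B) z *\<^sub>R (\<lambda>(r, y). G r y) z)"
    using Gcont by (intro borel_integrable_compact compact_Times) (auto simp: B_def)
  then have int2: "integrable (lborel \<Otimes>\<^sub>M lborel)
      (case_prod (\<lambda>r y. indicator {0..1::real} r *\<^sub>R (indicator B y *\<^sub>R G r y)))"
    unfolding lborel_prod
    by (rule back_subst[of "integrable lborel"]) (auto simp: fun_eq_iff indicator_def)
  \<comment> \<open>The 2 in the final denominator is the integral of \<open>r\<close> over the unit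
    interval.\<close>
  have "c * (I / 2) = (LINT r:{0..1}|lborel. c * I * r)"
  proof -
    have "(\<integral>r. indicator {0..1} r *\<^sub>R (c * I * r) \<partial>lborel) = c * I * 1\<^sup>2 / 2 - c * I * 0\<^sup>2 / 2"
      by (rule integral_FTC_atLeastAtMost)
        (auto intro!: derivative_eq_intros continuous_intros simp: has_real_derivative_iff_has_vector_derivative[symmetric])
    then show ?thesis unfolding set_lebesgue_integral_def by simp
  qed
  also have "\<dots> \<le> (LINT r:{0..1}|lborel. LINT y:B|lborel. G r y)"
  proof (rule set_integral_mono[OF _ _ Gy])
    show "set_integrable lborel {0..1} (\<lambda>r. c * I * r)"
      unfolding set_integrable_def by (intro borel_integrable_compact continuous_intros) auto
    show "set_integrable lborel {0..1} (\<lambda>r. LINT y:B|lborel. G r y)"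
      using lborel_pair.integrable_fst'[OF int2]
      by (simp add: set_integrable_def set_lebesgue_integral_def)
  qed
  also have "\<dots> = (\<integral>r. (\<integral>y. indicator {0..1} r *\<^sub>R (indicator B y *\<^sub>R G r y) \<partial>lborel) \<partial>lborel)"
    by (simp add: set_lebesgue_integral_def)
  also have "\<dots> = (\<integral>y. (\<integral>r. indicator {0..1} r *\<^sub>R (indicator B y *\<^sub>R G r y) \<partial>lborel) \<partial>lborel)"
    by (rule lborel_pair.Fubini_integral[OF int2, symmetric])
  also have "\<dots> = (LINT y:B|lborel. v y - v 0)"
    unfolding set_lebesgue_integral_def
  proof (rule Bochner_Integration.integral_cong[OF refl])
    fix y :: 'a
    show "(\<integral>r. indicator {0..1} r *\<^sub>R (indicator B y *\<^sub>R G r y) \<partial>lborel) = indicator B y *\<^sub>R (v y - v 0)"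
    proof (cases "y \<in> B")
      case True
      have "(\<integral>r. indicator {0..1} r *\<^sub>R G r y \<partial>lborel) = v (1 *\<^sub>R y) - v (0 *\<^sub>R y)"
      proof (rule integral_FTC_atLeastAtMost)
        fix r :: real assume r: "0 \<le> r" "r \<le> 1"
        then have rS: "r *\<^sub>R y \<in> S" using BS(2)[OF True] by simp
        have "((\<lambda>r. v (r *\<^sub>R y)) has_derivative (\<lambda>s. v' (r *\<^sub>R y) (s *\<^sub>R y))) (at r within {0..1})"
          by (rule has_derivative_compose[where f = "\<lambda>r. r *\<^sub>R y" and g = v])
            (auto intro!: derivative_eq_intros simp: v[OF rS])
        moreover have "v' (r *\<^sub>R y) (s *\<^sub>R y) = s *\<^sub>R G r y" for s
          using linear_scale[OF lin[OF rS]] G_eq[OF True, of r] r by simp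
        ultimately show "((\<lambda>r. v (r *\<^sub>R y)) has_vector_derivative G r y) (at r within {0..1})"
          by (simp add: has_vector_derivative_def)
      next
        show "continuous_on {0..1} (\<lambda>r. G r y)"
          using True by (intro continuous_on_compose2[OF Gcont, of _ "\<lambda>r. (r, y)", simplified] continuous_intros) auto
      qed simp
      then show ?thesis using True by simp
    qed simp
  qed
  finally show ?thesis
    unfolding I_def B_def w_def integral_cball_weight[OF \<open>R > 0\<close>] by (simp add: field_simps)
qed

section \<open>Norm bounds and the order of symmetric matrices\<close>

text \<open>The norm of a matrix is here its Frobenius norm, so Cauchy-Schwarz in each row
  suffices.\<close>

lemma norm_matrix_vector_mult_le: "norm (N *v x) \<le> norm N * norm x"
  for N :: "real^'n^'m"
proof -
  have "norm (N *v x) = L2_set (\<lambda>i. \<bar>N $ i \<bullet> x\<bar>) UNIV"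
    by (simp add: norm_vec_def matrix_vector_mul_component)
  also have "\<dots> \<le> L2_set (\<lambda>i. norm (N $ i) * norm x) UNIV"
    by (intro L2_set_mono Cauchy_Schwarz_ineq2) auto
  also have "\<dots> = norm N * norm x"
    by (simp add: norm_vec_def L2_set_left_distrib)
  finally show ?thesis .
qed

text \<open>Polarisation takes the place of the spectral theorem: with
  \<open>z = A *v y / \<phi>\<close>, the number \<open>4 * ((A *v y) \<bullet> z)\<close> is the
  difference of the quadratic forms at \<open>y + z\<close> and \<open>y - z\<close>. Dropping the
  second and bounding the first by \<open>\<phi>\<close> times the squared norm, then using the
  parallelogram law, leaves \<open>norm z \<le> norm y\<close>.\<close>

lemma norm_psd_mult_le:
  assumes A: "A \<in> psd_matrices" and le: "loewner_le A (\<phi> *\<^sub>R mat 1)" and "\<phi> > 0"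
  shows "norm (A *v y) \<le> \<phi> * norm y"
proof -
  have sym: "a \<bullet> (A *v b) = (A *v a) \<bullet> b" for a b
  proof -
    have "A *v a = a v* A"
      using A transpose_matrix_vector[of A a] by (simp add: psd_matrices_def sym_matrices_def)
    then show ?thesis by (simp only: dot_lmul_matrix)
  qed
  have nonneg: "0 \<le> a \<bullet> (A *v a)" for a
    using A by (simp add: psd_matrices_def)
  have upper: "a \<bullet> (A *v a) \<le> \<phi> * (a \<bullet> a)" for a
    using le unfolding loewner_le_def psd_matrices_def
    by (simp add: matrix_vector_mult_diff_rdistrib inner_diff_right scaleR_matrix_vector_assoc[symmetric])
  define z where "z = (1 / \<phi>) *\<^sub>R (A *v y)"
  have "4 * ((A *v y) \<bullet> z) = (y + z) \<bullet> (A *v (y + z)) - (y - z) \<bullet> (A *v (y - z))"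
    by (simp add: matrix_vector_right_distrib matrix_vector_mult_diff_distrib inner_simps sym[of y z]
        inner_commute[of z "A *v y"])
  also have "\<dots> \<le> \<phi> * ((y + z) \<bullet> (y + z))"
    using nonneg[of "y - z"] upper[of "y + z"] by linarith
  also have "\<dots> \<le> \<phi> * (2 * (y \<bullet> y) + 2 * (z \<bullet> z))"
    using \<open>\<phi> > 0\<close> inner_ge_zero[of "y - z"] by (intro mult_left_mono) (auto simp: inner_simps inner_commute[of z y])
  finally have *: "4 * ((A *v y) \<bullet> z) \<le> \<phi> * (2 * (y \<bullet> y) + 2 * (z \<bullet> z))" .
  have Az: "A *v y = \<phi> *\<^sub>R z" using \<open>\<phi> > 0\<close> by (simp add: z_def)
  have "\<phi> * (z \<bullet> z) \<le> \<phi> * (y \<bullet> y)"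
    using * by (simp add: Az algebra_simps)
  then have "norm z \<le> norm y"
    using \<open>\<phi> > 0\<close> by (simp add: norm_le)
  then show ?thesis using \<open>\<phi> > 0\<close> by (simp add: Az)
qed

text \<open>Ensures that a fixed matrix satisfies the constraint of the infimum as soon as \<phi>
  exceeds its norm.\<close>

lemma loewner_le_scaled_identity:
  assumes "A \<in> psd_matrices" "norm A \<le> t"
  shows "loewner_le A (t *\<^sub>R mat 1)"
proof -
  have "a \<bullet> (A *v a) \<le> t * (a \<bullet> a)" for a
  proof -
    have "a \<bullet> (A *v a) \<le> norm a * (norm A * norm a)"
      by (rule order_trans[OF norm_cauchy_schwarz mult_left_mono[OF norm_matrix_vector_mult_le norm_ge_zero]])
    also have "\<dots> = norm A * (a \<bullet> a)"
      by (simp add: power2_norm_eq_inner[symmetric] power2_eq_square)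
    also have "\<dots> \<le> t * (a \<bullet> a)" using assms by (intro mult_right_mono) auto
    finally show ?thesis .
  qed
  moreover have "transpose (t *\<^sub>R mat 1 - A) = t *\<^sub>R mat 1 - A"
    using assms(1) by (auto simp: psd_matrices_def sym_matrices_def transpose_def vec_eq_iff mat_def)
  ultimately show ?thesis
    by (auto simp: loewner_le_def psd_matrices_def sym_matrices_def matrix_vector_mult_diff_rdistrib
        inner_diff_right scaleR_matrix_vector_assoc[symmetric])
qed

section \<open>Traces of conjugates and semicontinuity of their infimum\<close>

text \<open>Written as a sum of quadratic forms, the trace is visibly linear in \<open>M\<close>,
  can be estimated by Cauchy-Schwarz, and matches a Laplacian taken along the columns of
  \<open>A\<close>.\<close>

lemma trace_conj_eq_sum_columns:
  fixes A M :: "real^'n^'n"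
  shows "trace (transpose A ** M ** A) = (\<Sum>i\<in>UNIV. column i A \<bullet> (M *v column i A))"
proof -
  have "(transpose A ** M ** A) $ i $ i = column i A \<bullet> (M *v column i A)" for i
    unfolding matrix_mul_assoc[symmetric]
    by (simp add: matrix_matrix_mult_def matrix_vector_mult_def transpose_def column_def inner_vec_def)
  then show ?thesis by (simp add: trace_def)
qed

lemma trace_conj_scaled_identity:
  fixes A :: "real^'n^'n"
  shows "trace (transpose A ** (t *\<^sub>R mat 1) ** A) = t * (\<Sum>i\<in>UNIV. (norm (column i A))\<^sup>2)"
  by (simp add: trace_conj_eq_sum_columns scaleR_matrix_vector_assoc[symmetric] sum_distrib_left power2_norm_eq_inner)

lemma trace_conj_diff:
  fixes A M N :: "real^'n^'n"
  shows "trace (transpose A ** (M - N) ** A) = trace (transpose A ** M ** A) - trace (transpose A ** N ** A)"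
  by (simp add: trace_conj_eq_sum_columns matrix_vector_mult_diff_rdistrib inner_diff_right sum_subtractf)

lemma abs_trace_conj_le:
  fixes A N :: "real^'n^'n"
  shows "\<bar>trace (transpose A ** N ** A)\<bar> \<le> norm N * (\<Sum>i\<in>UNIV. (norm (column i A))\<^sup>2)"
proof -
  have "\<bar>a \<bullet> (N *v a)\<bar> \<le> norm N * (norm a)\<^sup>2" for a
  proof -
    have "\<bar>a \<bullet> (N *v a)\<bar> \<le> norm a * (norm N * norm a)"
      by (rule order_trans[OF Cauchy_Schwarz_ineq2 mult_left_mono[OF norm_matrix_vector_mult_le norm_ge_zero]])
    then show ?thesis by (simp only: power2_eq_square mult_ac)
  qed
  then show ?thesis
    unfolding trace_conj_eq_sum_columns sum_distrib_left
    by (intro order_trans[OF sum_abs] sum_mono)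
qed

text \<open>If \<open>M - \<delta> I\<close> still lies in \<open>\<Gamma>\<close>, then \<open>trace (A\<^sup>t M A)\<close> controls \<open>\<delta> |A|\<^sup>2\<close> uniformly in \<open>A\<close>,
  so that a perturbation of \<open>M\<close> changes it only by a small relative amount.\<close>

lemma lower_semicontinuous_trace_inf_op:
  fixes \<A> :: "(real^'n^'n) set"
  assumes M: "M \<in> (top_of_set sym_matrices) interior_of (Gamma_set \<A>)"
    and fin: "trace_inf_op \<A> M < \<infinity>"
  shows "lower_semicontinuous_at_within M S (trace_inf_op \<A>)"
  unfolding lower_semicontinuous_at_within_def
proof (intro allI impI)
  fix c assume c: "c < trace_inf_op \<A> M"
  have "M \<in> Gamma_set \<A>" using interior_of_subset M by (rule subsetD)
  then have M_sym: "M \<in> sym_matrices" and "trace_inf_op \<A> M > -\<infinity>" by (auto simp: Gamma_set_def)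
  with fin obtain f where f: "trace_inf_op \<A> M = ereal f" by (cases "trace_inf_op \<A> M") auto
  have f_le: "f \<le> trace (transpose A ** M ** A)" if "A \<in> \<A>" for A
    using INF_lower[OF that, of "\<lambda>A. ereal (trace (transpose A ** M ** A))"] f
    by (simp add: trace_inf_op_def)
  obtain T where T: "openin (top_of_set sym_matrices) T" "T \<subseteq> Gamma_set \<A>" "M \<in> T"
    using M by (auto simp: interior_of_def)
  have "\<exists>e>0. ball M e \<inter> sym_matrices \<subseteq> T"
    using openin_contains_ball[THEN iffD1, OF T(1)] T(3) by (rule conjunct2[THEN bspec])
  then obtain e where "e > 0" and e: "ball M e \<inter> sym_matrices \<subseteq> T" by auto
  \<comment> \<open>Small enough that \<open>M - \<delta> *\<^sub>R mat 1\<close> stays within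
    \<open>e\<close> of \<open>M\<close>; the added 1 keeps the denominator positive without
    computing the norm of the identity.\<close>
  define \<delta> where "\<delta> = e / (2 * (norm (mat 1 :: real^'n^'n) + 1))"
  have "\<delta> > 0" using \<open>e > 0\<close> by (simp add: \<delta>_def add_nonneg_pos)
  have "\<delta> * norm (mat 1 :: real^'n^'n) < e"
  proof -
    have "norm (mat 1 :: real^'n^'n) + 1 > 0"
      by (simp add: add_nonneg_pos)
    then have "\<delta> * (2 * (norm (mat 1 :: real^'n^'n) + 1)) = e"
      by (simp add: \<delta>_def)
    then have "2 * (\<delta> * norm (mat 1 :: real^'n^'n)) + 2 * \<delta> = e"
      by (simp add: algebra_simps)
    moreover have "0 \<le> \<delta> * norm (mat 1 :: real^'n^'n)" using \<open>\<delta> > 0\<close> by simp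
    ultimately show ?thesis using \<open>\<delta> > 0\<close> by linarith
  qed
  then have "M - \<delta> *\<^sub>R mat 1 \<in> ball M e"
    using \<open>\<delta> > 0\<close> by (simp add: dist_norm)
  moreover have "M - \<delta> *\<^sub>R mat 1 \<in> sym_matrices"
    using M_sym by (auto simp: sym_matrices_def transpose_def vec_eq_iff mat_def)
  ultimately have "M - \<delta> *\<^sub>R mat 1 \<in> Gamma_set \<A>" using e T(2) by blast
  then have "trace_inf_op \<A> (M - \<delta> *\<^sub>R mat 1) > -\<infinity>" by (simp add: Gamma_set_def)
  then obtain K where K: "ereal K < trace_inf_op \<A> (M - \<delta> *\<^sub>R mat 1)"
    using ereal_dense2[of "-\<infinity>"] by blast
  have K_le: "K \<le> trace (transpose A ** M ** A) - \<delta> * (\<Sum>i\<in>UNIV. (norm (column i A))\<^sup>2)" if "A \<in> \<A>" for A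
  proof -
    have "trace_inf_op \<A> (M - \<delta> *\<^sub>R mat 1) \<le> ereal (trace (transpose A ** (M - \<delta> *\<^sub>R mat 1) ** A))"
      unfolding trace_inf_op_def using that by (rule INF_lower)
    with K have "ereal K < ereal (trace (transpose A ** (M - \<delta> *\<^sub>R mat 1) ** A))"
      by (rule less_le_trans)
    then show ?thesis by (simp add: trace_conj_diff trace_conj_scaled_identity)
  qed
  \<comment> \<open>A combination of the bounds \<open>f\<close> for the trace and \<open>K\<close>
    for the trace minus \<open>\<delta> * q\<close>, where \<open>q\<close> is the squared Frobenius
    norm of \<open>A\<close>. The weight \<open>norm (N - M) / \<delta>\<close> is chosen so that
    the subtracted term becomes \<open>norm (N - M) * q\<close>, exactly the possible loss from
    replacing \<open>M\<close> by \<open>N\<close>. The bound does not involve \<open>A\<close> and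
    tends to \<open>f\<close>.\<close>
  define b where "b N = (1 - norm (N - M) / \<delta>) * f + norm (N - M) / \<delta> * K" for N
  have lower: "ereal (b N) \<le> trace_inf_op \<A> N" if N: "norm (N - M) < \<delta>" for N
    unfolding trace_inf_op_def
  proof (rule INF_greatest)
    fix A assume A: "A \<in> \<A>"
    define \<eta> where "\<eta> = norm (N - M)"
    define t where "t = trace (transpose A ** M ** A)"
    define q where "q = (\<Sum>i\<in>UNIV. (norm (column i A))\<^sup>2)"
    have \<eta>: "0 \<le> \<eta> / \<delta>" "\<eta> / \<delta> \<le> 1" using N \<open>\<delta> > 0\<close> by (auto simp: \<eta>_def)
    have "b N = (1 - \<eta> / \<delta>) * f + \<eta> / \<delta> * K" by (simp add: b_def \<eta>_def)
    also have "\<dots> \<le> (1 - \<eta> / \<delta>) * t + \<eta> / \<delta> * (t - \<delta> * q)"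
      using f_le[OF A] K_le[OF A] \<eta> by (intro add_mono mult_left_mono) (auto simp: t_def q_def)
    also have "\<dots> = t - \<eta> * q" using \<open>\<delta> > 0\<close> by (simp add: field_simps)
    also have "\<dots> \<le> trace (transpose A ** N ** A)"
      using abs_trace_conj_le[of A "N - M"] by (simp add: trace_conj_diff t_def q_def \<eta>_def)
    finally show "ereal (b N) \<le> ereal (trace (transpose A ** N ** A))" by simp
  qed
  have "(b \<longlongrightarrow> (1 - norm (M - M) / \<delta>) * f + norm (M - M) / \<delta> * K) (at M within S)"
    unfolding b_def[abs_def] using \<open>\<delta> > 0\<close> by (intro tendsto_intros) auto
  then have "((\<lambda>N. ereal (b N)) \<longlongrightarrow> ereal f) (at M within S)" by simp
  then have "\<forall>\<^sub>F N in at M within S. c < ereal (b N)"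
    using c f by (intro order_tendstoD(1)) auto
  moreover have "\<forall>\<^sub>F N in at M within S. norm (N - M) < \<delta>"
    using \<open>\<delta> > 0\<close> by (auto simp: eventually_at dist_norm)
  ultimately show "\<forall>\<^sub>F N in at M within S. c < trace_inf_op \<A> N"
    by eventually_elim (erule less_le_trans, erule lower)
qed

section \<open>Ball means of the composition of \<open>u\<close> with an affine map\<close>

lemma sum_Basis_cart:
  fixes f :: "real^'n \<Rightarrow> real"
  shows "(\<Sum>b\<in>Basis. f b) = (\<Sum>i\<in>UNIV. f (axis i 1))"
proof -
  have B: "(Basis :: (real^'n) set) = range (\<lambda>i. axis i 1)" by (auto simp: Basis_vec_def)
  show ?thesis unfolding B
    by (subst sum.reindex) (simp_all add: inj_on_def axis_eq_axis)
qed

lemma has_derivative_partial_deriv: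
  fixes f :: "real^'n \<Rightarrow> real"
  assumes "f differentiable (at z)"
  shows "(f has_derivative (\<lambda>h. \<Sum>i\<in>UNIV. h $ i * partial_deriv i f z)) (at z)"
proof -
  let ?D = "frechet_derivative f (at z)"
  have D: "(f has_derivative ?D) (at z)" using assms by (simp only: frechet_derivative_works)
  note lin = has_derivative_linear[OF D]
  have "?D h = (\<Sum>i\<in>UNIV. h $ i * partial_deriv i f z)" for h
  proof -
    have "?D h = ?D (\<Sum>i\<in>UNIV. h $ i *\<^sub>R axis i 1)"
      using basis_expansion[of h] by (simp add: scalar_mult_eq_scaleR)
    also have "\<dots> = (\<Sum>i\<in>UNIV. h $ i * partial_deriv i f z)"
      by (simp only: linear_sum[OF lin] linear_scale[OF lin] partial_deriv_def real_scaleR_def)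
    finally show ?thesis .
  qed
  then have "?D = (\<lambda>h. \<Sum>i\<in>UNIV. h $ i * partial_deriv i f z)" by (rule ext)
  with D show ?thesis by (simp only:)
qed

text \<open>Links \<open>ball_mean\<close>, defined on the open ball, with the closed ball, where
  compactness supplies integrability; the sphere between them is null.\<close>

lemma set_integral_ball_eq_cball:
  fixes f :: "'a::euclidean_space \<Rightarrow> real"
  assumes f: "continuous_on (cball 0 R) f"
  shows "(LINT y:ball 0 R|lborel. f y) = (LINT y:cball 0 R|lborel. f y)"
proof -
  have int: "set_integrable lborel (cball 0 R) f"
    unfolding set_integrable_def using f by (intro borel_integrable_compact compact_cball)
  then have "set_integrable lborel (ball 0 R) f"
    by (rule set_integrable_subset) (auto simp: ball_subset_cball)
  with int show ?thesis
    unfolding set_lebesgue_integral_def set_integrable_def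
  proof (intro integral_cong_AE)
    show "AE y in lborel. indicator (ball 0 R) y *\<^sub>R f y = indicator (cball 0 R) y *\<^sub>R f y"
      using AE_lborel_not_in_sphere[of 0 R] by eventually_elim (auto simp: indicator_def)
  qed auto
qed

text \<open>The factor \<open>s\<close> lets the same lemma give lower (\<open>s = 1\<close>) and upper (\<open>s = -1\<close>) bounds.\<close>

lemma ball_mean_scaled_ge:
  fixes u :: "real^'n \<Rightarrow> real"
  assumes "open \<Omega>" and u: "C2_on \<Omega> u" and "\<epsilon> > 0"
    and sub: "\<And>y. y \<in> cball 0 \<epsilon> \<Longrightarrow> x + A *v y \<in> \<Omega>"
    and ge: "\<And>y. y \<in> cball 0 \<epsilon> \<Longrightarrow> c \<le> s * trace (transpose A ** hessian u (x + A *v y) ** A)"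
  shows "c \<le> s * (2 * (real CARD('n) + 2) * ball_mean u x \<epsilon> A)"
proof -
  define S where "S = (\<lambda>y. x + A *v y) -` \<Omega>"
  \<comment> \<open>\<open>v'\<close> and \<open>p b\<close> are the first and second derivatives of
    \<open>v\<close> given by the chain rule, in terms of the partial derivatives that
    \<open>C2_on\<close> controls.\<close>
  define v where "v y = s * u (x + A *v y)" for y
  define v' where "v' y h = s * (\<Sum>j\<in>UNIV. (A *v h) $ j * partial_deriv j u (x + A *v y))" for y h
  define p where "p b y h = s * (\<Sum>j\<in>UNIV. (A *v b) $ j *
      (\<Sum>k\<in>UNIV. (A *v h) $ k * partial_deriv k (partial_deriv j u) (x + A *v y)))" for b y h
  have affine: "continuous_on X (\<lambda>y. x + A *v y)" for X
    by (intro continuous_intros linear_continuous_on matrix_vector_mul_bounded_linear)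
  have "open S" unfolding S_def
    by (intro open_vimage \<open>open \<Omega>\<close> affine)
  have "cball 0 \<epsilon> \<subseteq> S" using sub by (auto simp: S_def)
  have d_affine: "((\<lambda>y. x + A *v y) has_derivative (\<lambda>h. A *v h)) (at y)" for y
    using has_derivative_add[OF has_derivative_const[of x]
        bounded_linear_imp_has_derivative[OF matrix_vector_mul_bounded_linear[of A]], of "at y"] by simp
  have v: "(v has_derivative v' y) (at y)" if "y \<in> S" for y
  proof -
    have "x + A *v y \<in> \<Omega>" using that by (simp add: S_def)
    then have "u differentiable (at (x + A *v y))" using u by (simp add: C2_on_def)
    from has_derivative_compose[where f = "\<lambda>y. x + A *v y" and g = u, OF d_affine has_derivative_partial_deriv[OF this]]
    show ?thesis unfolding v_def[abs_def] v'_def[abs_def] by (rule has_derivative_mult_right)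
  qed
  have p: "((\<lambda>z. v' z b) has_derivative p b y) (at y)" if "y \<in> S" for b y
  proof -
    have "x + A *v y \<in> \<Omega>" using that by (simp add: S_def)
    then have "partial_deriv j u differentiable (at (x + A *v y))" for j using u by (simp add: C2_on_def)
    from has_derivative_compose[where f = "\<lambda>y. x + A *v y" and g = "partial_deriv _ u",
        OF d_affine has_derivative_partial_deriv[OF this]]
    show ?thesis unfolding v'_def p_def[abs_def]
      by (intro has_derivative_mult_right has_derivative_sum)
  qed
  have cont: "continuous_on S (\<lambda>y. p b y b)" for b
    unfolding p_def using u
    by (intro continuous_intros continuous_on_compose2[OF _ affine, of \<Omega>]) (auto simp: C2_on_def S_def)
  have trace_eq: "(\<Sum>b\<in>Basis. p b y b) = s * trace (transpose A ** hessian u (x + A *v y) ** A)" for y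
  proof -
    have "column i A \<bullet> (hessian u (x + A *v y) *v column i A) =
       (\<Sum>j\<in>UNIV. column i A $ j * (\<Sum>k\<in>UNIV. column i A $ k * partial_deriv k (partial_deriv j u) (x + A *v y)))" for i
    proof -
      let ?c = "column i A" and ?H = "\<lambda>j k. partial_deriv j (partial_deriv k u) (x + A *v y)"
      have "?c \<bullet> (hessian u (x + A *v y) *v ?c) = (\<Sum>j\<in>UNIV. \<Sum>k\<in>UNIV. ?c $ j * (?H j k * ?c $ k))"
        by (simp add: inner_vec_def matrix_vector_mult_def hessian_def sum_distrib_left)
      \<comment> \<open>The chain rule and \<open>hessian\<close> order the two differentiations
        differently. Both arguments of the form are the same column, so exchanging the sums is
        enough and symmetry of the second derivatives is not invoked.\<close>
      also have "\<dots> = (\<Sum>k\<in>UNIV. \<Sum>j\<in>UNIV. ?c $ j * (?H j k * ?c $ k))"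
        by (rule sum.swap)
      finally show ?thesis by (simp add: sum_distrib_left mult_ac)
    qed
    then show ?thesis
      unfolding sum_Basis_cart p_def trace_conj_eq_sum_columns
      by (simp add: matrix_vector_mult_basis sum_distrib_left)
  qed
  have vcont: "continuous_on (cball 0 \<epsilon>) v"
    using v \<open>cball 0 \<epsilon> \<subseteq> S\<close> by (meson continuous_at_imp_continuous_on has_derivative_continuous subsetD)
  let ?m = "measure lborel (cball (0::real^'n) \<epsilon>)"
  have "c * (\<epsilon>\<^sup>2 * ?m / (2 * (real DIM(real^'n) + 2))) \<le> (LINT y:cball 0 \<epsilon>|lborel. v y - v 0)"
    by (rule mean_value_inequality_cball[OF \<open>open S\<close> \<open>cball 0 \<epsilon> \<subseteq> S\<close> \<open>\<epsilon> > 0\<close> v p cont])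
      (use ge trace_eq in auto)
  also have "\<dots> = (LINT y:ball 0 \<epsilon>|lborel. v y - v 0)"
    by (intro set_integral_ball_eq_cball[symmetric] continuous_intros vcont)
  also have "\<dots> = (LINT y:ball 0 \<epsilon>|lborel. (s * \<epsilon>\<^sup>2) * ((u (x + A *v y) - u x) / \<epsilon>\<^sup>2))"
  proof -
    have "v y - v 0 = (s * \<epsilon>\<^sup>2) * ((u (x + A *v y) - u x) / \<epsilon>\<^sup>2)" for y
      using \<open>\<epsilon> > 0\<close> by (simp add: v_def) (simp add: algebra_simps diff_divide_distrib)
    then show ?thesis by (simp only:)
  qed
  also have "\<dots> = (s * \<epsilon>\<^sup>2) * (LINT y:ball 0 \<epsilon>|lborel. (u (x + A *v y) - u x) / \<epsilon>\<^sup>2)"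
    by (rule set_integral_mult_right)
  also have "\<dots> = (s * \<epsilon>\<^sup>2) * (?m * ball_mean u x \<epsilon> A)"
  proof -
    have "measure lborel (ball (0::real^'n) \<epsilon>) = ?m"
      using \<open>\<epsilon> > 0\<close> by (simp add: content_ball content_cball)
    moreover have "?m \<noteq> 0" using \<open>\<epsilon> > 0\<close> by (simp only: content_cball_eq_0_iff)
    ultimately show ?thesis by (simp only: ball_mean_def) simp
  qed
  finally have "c * (\<epsilon>\<^sup>2 * ?m / (2 * (real CARD('n) + 2))) \<le> (s * \<epsilon>\<^sup>2) * (?m * ball_mean u x \<epsilon> A)"
    by simp
  then have "c * (\<epsilon>\<^sup>2 * ?m) / (2 * (real CARD('n) + 2)) \<le> (s * \<epsilon>\<^sup>2) * (?m * ball_mean u x \<epsilon> A)"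
    by (simp only: times_divide_eq_right)
  then have "c * (\<epsilon>\<^sup>2 * ?m) \<le> (s * \<epsilon>\<^sup>2) * (?m * ball_mean u x \<epsilon> A) * (2 * (real CARD('n) + 2))"
    by (subst (asm) pos_divide_le_eq) auto
  then have "c * (\<epsilon>\<^sup>2 * ?m) \<le> (s * (2 * (real CARD('n) + 2) * ball_mean u x \<epsilon> A)) * (\<epsilon>\<^sup>2 * ?m)"
    by (simp only: mult_ac)
  moreover have "\<epsilon>\<^sup>2 * ?m > 0"
    using \<open>\<epsilon> > 0\<close> by simp
  ultimately show ?thesis
    by (rule mult_right_le_imp_le)
qed

section \<open>Asymptotics of the infimum of the ball means\<close>

lemma continuous_on_hessian:
  assumes "C2_on \<Omega> u"
  shows "continuous_on \<Omega> (hessian u)"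
  using assms unfolding C2_on_def hessian_def[abs_def] by (intro continuous_on_vec_lambda) auto

text \<open>With the constant inside the infimum, each bound concerns single matrices: the lower one
  must hold for all admissible \<open>A\<close> at the same \<epsilon>, whereas the upper one needs
  only one \<open>A\<close>, fixed before \<epsilon>.\<close>

lemma eventually_trace_inf_op_scaled_mean_bounds:
  fixes \<Omega> :: "(real^'n) set"
    and \<phi> :: "real \<Rightarrow> real"
    and \<A> :: "(real^'n^'n) set"
    and u :: "real^'n \<Rightarrow> real"
  defines "L \<equiv> (\<lambda>x \<epsilon>. INF A\<in>{A \<in> \<A>. loewner_le A (\<phi> \<epsilon> *\<^sub>R mat 1)}. ereal (2 * (real CARD('n) + 2) * ball_mean u x \<epsilon> A))"
  assumes "open \<Omega>"
    and \<phi>_top: "filterlim \<phi> at_top (at_right 0)"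
    and \<phi>_zero: "((\<lambda>\<epsilon>. \<epsilon> * \<phi> \<epsilon>) \<longlongrightarrow> 0) (at_right 0)"
    and psd: "\<A> \<subseteq> psd_matrices"
    and u: "C2_on \<Omega> u" "admissible \<A> \<Omega> u"
    and x: "x \<in> \<Omega>"
    and lsc: "lower_semicontinuous_at_within (hessian u x) (Gamma_set \<A>) (trace_inf_op \<A>)"
    and f: "trace_inf_op \<A> (hessian u x) = ereal f"
    and "e > 0"
  shows "\<forall>\<^sub>F \<epsilon> in at_right 0. ereal (f - e) \<le> L x \<epsilon> \<and> L x \<epsilon> \<le> ereal (f + e)"
proof -
  define M where "M = hessian u x"
  have cont: "isCont (hessian u) x"
    using continuous_on_hessian[OF u(1)] \<open>open \<Omega>\<close> x by (simp add: continuous_on_eq_continuous_at)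
  have in_\<Omega>: "\<forall>\<^sub>F z in nhds x. z \<in> \<Omega>"
    using \<open>open \<Omega>\<close> x by (rule eventually_nhds_in_open)
  have pos: "\<forall>\<^sub>F \<epsilon> in at_right 0. (0::real) < \<epsilon>"
    by (rule eventually_at_right_less)

  have lower: "\<forall>\<^sub>F \<epsilon> in at_right 0. ereal (f - e) \<le> L x \<epsilon>"
  proof -
    have "\<forall>\<^sub>F N in at M within Gamma_set \<A>. ereal (f - e) < trace_inf_op \<A> N"
      using lsc f \<open>e > 0\<close> unfolding lower_semicontinuous_at_within_def M_def by simp
    \<comment> \<open>The punctured neighbourhood is completed at \<open>M\<close> itself, where the
      claim is \<open>f - e < f\<close>. Membership in \<open>Gamma_set \<A>\<close> stays as a
      premise until admissibility of \<open>u\<close> discharges it.\<close>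
    then have ev: "\<forall>\<^sub>F N in nhds M. N \<in> Gamma_set \<A> \<longrightarrow> ereal (f - e) < trace_inf_op \<A> N"
      unfolding eventually_at_filter
      by eventually_elim (use f \<open>e > 0\<close> in \<open>auto simp: M_def\<close>)
    have "filterlim (hessian u) (nhds M) (nhds x)"
      using cont tendsto_at_iff_tendsto_nhds[of "hessian u" x] by (simp add: isCont_def M_def)
    from eventually_compose_filterlim[OF ev this]
    have "\<forall>\<^sub>F z in nhds x. hessian u z \<in> Gamma_set \<A> \<longrightarrow> ereal (f - e) < trace_inf_op \<A> (hessian u z)" .
    with in_\<Omega> have "\<forall>\<^sub>F z in nhds x. z \<in> \<Omega> \<and> ereal (f - e) < trace_inf_op \<A> (hessian u z)"
      by eventually_elim (use u(2) in \<open>auto simp: admissible_def\<close>)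
    then obtain \<rho> where "\<rho> > 0" and \<rho>: "\<And>z. dist z x < \<rho> \<Longrightarrow> z \<in> \<Omega> \<and> ereal (f - e) < trace_inf_op \<A> (hessian u z)"
      unfolding eventually_nhds_metric by auto
    have "\<forall>\<^sub>F \<epsilon> in at_right 0. \<epsilon> * \<phi> \<epsilon> < \<rho>"
      using order_tendstoD(2)[OF \<phi>_zero \<open>\<rho> > 0\<close>] .
    moreover have "\<forall>\<^sub>F \<epsilon> in at_right 0. 0 < \<phi> \<epsilon>"
      using \<phi>_top by (simp add: filterlim_at_top_dense)
    ultimately show ?thesis
      using pos
    proof eventually_elim
      case (elim \<epsilon>)
      show ?case
        unfolding L_def
      proof (rule INF_greatest)
        fix A assume "A \<in> {A \<in> \<A>. loewner_le A (\<phi> \<epsilon> *\<^sub>R mat 1)}"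
        then have A: "A \<in> \<A>" "A \<in> psd_matrices" "loewner_le A (\<phi> \<epsilon> *\<^sub>R mat 1)" using psd by auto
        \<comment> \<open>The radius \<rho> was chosen before \<open>A\<close>, and the displacement
          is at most \<open>\<phi> \<epsilon> * \<epsilon>\<close>; this is what makes the estimate
          uniform in \<open>A\<close>.\<close>
        have near: "dist (x + A *v y) x < \<rho>" if "y \<in> cball 0 \<epsilon>" for y
        proof -
          have "dist (x + A *v y) x = norm (A *v y)" by (simp add: dist_norm)
          also have "\<dots> \<le> \<phi> \<epsilon> * norm y" by (rule norm_psd_mult_le[OF A(2,3) elim(2)])
          also have "\<dots> \<le> \<phi> \<epsilon> * \<epsilon>" using that elim(2) by (intro mult_left_mono) auto
          finally show ?thesis using elim(1) by (simp add: mult.commute)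
        qed
        have "f - e \<le> 1 * (2 * (real CARD('n) + 2) * ball_mean u x \<epsilon> A)"
        proof (rule ball_mean_scaled_ge[OF \<open>open \<Omega>\<close> u(1) elim(3)])
          fix y :: "real^'n" assume y: "y \<in> cball 0 \<epsilon>"
          show "x + A *v y \<in> \<Omega>" using \<rho>[OF near[OF y]] by blast
          have "ereal (f - e) < trace_inf_op \<A> (hessian u (x + A *v y))" using \<rho>[OF near[OF y]] by blast
          also have "\<dots> \<le> ereal (trace (transpose A ** hessian u (x + A *v y) ** A))"
            unfolding trace_inf_op_def using A(1) by (rule INF_lower)
          finally show "f - e \<le> 1 * trace (transpose A ** hessian u (x + A *v y) ** A)" by simp
        qed
        then show "ereal (f - e) \<le> ereal (2 * (real CARD('n) + 2) * ball_mean u x \<epsilon> A)" by simp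
      qed
    qed
  qed

  have upper: "\<forall>\<^sub>F \<epsilon> in at_right 0. L x \<epsilon> \<le> ereal (f + e)"
  proof -
    have "trace_inf_op \<A> M < ereal (f + e)" using f \<open>e > 0\<close> by (simp add: M_def)
    \<comment> \<open>An almost optimal matrix for \<open>M\<close>. Since \<phi> tends to infinity,
      it eventually satisfies the constraint.\<close>
    then obtain A where A: "A \<in> \<A>" "trace (transpose A ** M ** A) < f + e"
      unfolding trace_inf_op_def INF_less_iff by auto
    have A_psd: "A \<in> psd_matrices" using A psd by blast
    have "isCont (\<lambda>z. trace (transpose A ** hessian u z ** A)) x"
      unfolding trace_conj_eq_sum_columns inner_vec_def matrix_vector_mult_def
      by (simp, intro continuous_intros cont)
    then have "((\<lambda>z. trace (transpose A ** hessian u z ** A)) \<longlongrightarrow> trace (transpose A ** M ** A)) (nhds x)"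
      using tendsto_at_iff_tendsto_nhds[of "\<lambda>z. trace (transpose A ** hessian u z ** A)" x]
      by (simp add: isCont_def M_def)
    from order_tendstoD(2)[OF this A(2)]
    have "\<forall>\<^sub>F z in nhds x. trace (transpose A ** hessian u z ** A) < f + e" .
    with in_\<Omega> have "\<forall>\<^sub>F z in nhds x. z \<in> \<Omega> \<and> trace (transpose A ** hessian u z ** A) < f + e"
      by eventually_elim simp
    then obtain \<rho> where "\<rho> > 0" and \<rho>: "\<And>z. dist z x < \<rho> \<Longrightarrow> z \<in> \<Omega> \<and> trace (transpose A ** hessian u z ** A) < f + e"
      unfolding eventually_nhds_metric by auto
    have "((\<lambda>\<epsilon>. norm A * \<epsilon>) \<longlongrightarrow> norm A * 0) (at_right (0::real))"
      by (intro tendsto_intros)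
    then have "\<forall>\<^sub>F \<epsilon> in at_right 0. norm A * \<epsilon> < \<rho>"
      using \<open>\<rho> > 0\<close> by (intro order_tendstoD(2)) auto
    moreover have "\<forall>\<^sub>F \<epsilon> in at_right 0. norm A \<le> \<phi> \<epsilon>"
      using \<phi>_top by (simp add: filterlim_at_top)
    ultimately show ?thesis
      using pos
    proof eventually_elim
      case (elim \<epsilon>)
      have near: "dist (x + A *v y) x < \<rho>" if "y \<in> cball 0 \<epsilon>" for y
      proof -
        have "dist (x + A *v y) x = norm (A *v y)" by (simp add: dist_norm)
        also have "\<dots> \<le> norm A * norm y" by (rule norm_matrix_vector_mult_le)
        also have "\<dots> \<le> norm A * \<epsilon>" using that by (intro mult_left_mono) auto
        finally show ?thesis using elim(1) by simp
      qed
      have "- (f + e) \<le> (- 1) * (2 * (real CARD('n) + 2) * ball_mean u x \<epsilon> A)"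
      proof (rule ball_mean_scaled_ge[OF \<open>open \<Omega>\<close> u(1) elim(3)])
        fix y :: "real^'n" assume y: "y \<in> cball 0 \<epsilon>"
        show "x + A *v y \<in> \<Omega>" using \<rho>[OF near[OF y]] by blast
        show "- (f + e) \<le> (- 1) * trace (transpose A ** hessian u (x + A *v y) ** A)"
          using \<rho>[OF near[OF y]] by simp
      qed
      then have "ereal (2 * (real CARD('n) + 2) * ball_mean u x \<epsilon> A) \<le> ereal (f + e)" by simp
      moreover have "A \<in> {A \<in> \<A>. loewner_le A (\<phi> \<epsilon> *\<^sub>R mat 1)}"
        using A(1) loewner_le_scaled_identity[OF A_psd elim(2)] by simp
      ultimately show ?case
        unfolding L_def by (rule INF_lower2[rotated])
    qed
  qed

  show ?thesis using lower upper by (rule eventually_conj)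
qed

text \<open>Finiteness from above encodes that \<open>F\<close> takes values in the reals and minus
  infinity; as an infimum over the empty set is infinite, it says that \<open>\<A>\<close> is
  nonempty. The remainder is a real function, and the identity is stated for all small positive
  \<epsilon>, where the infimum is finite.\<close>

theorem theorem1p1:
  fixes \<Omega> :: "(real^'n) set"
    and \<phi> :: "real \<Rightarrow> real"
    and \<A> :: "(real^'n^'n) set"
    and u :: "real^'n \<Rightarrow> real"
  assumes "open \<Omega>"
    and "\<And>\<epsilon>. \<epsilon> > 0 \<Longrightarrow> \<phi> \<epsilon> > 0"
    and "filterlim \<phi> at_top (at_right 0)"
    and "((\<lambda>\<epsilon>. \<epsilon> * \<phi> \<epsilon>) \<longlongrightarrow> 0) (at_right 0)"
    and "\<A> \<subseteq> psd_matrices"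
    and "\<And>M. M \<in> sym_matrices \<Longrightarrow> trace_inf_op \<A> M < \<infinity>"
    and "\<And>M. M \<in> Gamma_set \<A> - (top_of_set sym_matrices) interior_of (Gamma_set \<A>) \<Longrightarrow>
           lower_semicontinuous_at_within M (Gamma_set \<A>) (trace_inf_op \<A>)"
    and "C2_on \<Omega> u"
    and "admissible \<A> \<Omega> u"
  shows "\<forall>x\<in>\<Omega>. \<exists>r :: real \<Rightarrow> real. r \<in> o[at_right 0](\<lambda>_. 1) \<and>
           (\<forall>\<^sub>F \<epsilon> in at_right 0.
              trace_inf_op \<A> (hessian u x) =
                ereal (2 * (real CARD('n) + 2)) *
                  (INF A\<in>{A \<in> \<A>. loewner_le A (\<phi> \<epsilon> *\<^sub>R mat 1)}. ereal (ball_mean u x \<epsilon> A))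
                + ereal (r \<epsilon>))"
proof
  fix x assume x: "x \<in> \<Omega>"
  define C where "C = 2 * (real CARD('n) + 2)"
  define I where "I \<epsilon> = (INF A\<in>{A \<in> \<A>. loewner_le A (\<phi> \<epsilon> *\<^sub>R mat 1)}. ereal (ball_mean u x \<epsilon> A))" for \<epsilon>
  have "C > 0" by (simp add: C_def add_nonneg_pos)
  have \<Gamma>: "hessian u x \<in> Gamma_set \<A>" using assms(9) x by (simp add: admissible_def)
  then have sym: "hessian u x \<in> sym_matrices" and "trace_inf_op \<A> (hessian u x) > -\<infinity>"
    by (auto simp: Gamma_set_def)
  with assms(6) obtain f where f: "trace_inf_op \<A> (hessian u x) = ereal f"
    by (cases "trace_inf_op \<A> (hessian u x)") fastforce+
  \<comment> \<open>Semicontinuity is a hypothesis only off the interior of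
    \<open>Gamma_set \<A>\<close>; at interior points it is supplied by
    \<open>lower_semicontinuous_trace_inf_op\<close>.\<close>
  have lsc: "lower_semicontinuous_at_within (hessian u x) (Gamma_set \<A>) (trace_inf_op \<A>)"
  proof (cases "hessian u x \<in> (top_of_set sym_matrices) interior_of (Gamma_set \<A>)")
    case True
    then show ?thesis using assms(6)[OF sym] by (rule lower_semicontinuous_trace_inf_op)
  next
    case False
    then show ?thesis using \<Gamma> by (intro assms(7)) simp
  qed
  have CI: "(INF A\<in>{A \<in> \<A>. loewner_le A (\<phi> \<epsilon> *\<^sub>R mat 1)}. ereal (C * ball_mean u x \<epsilon> A)) = ereal C * I \<epsilon>" for \<epsilon>
    using ereal_Inf_cmult[OF \<open>C > 0\<close>, of "\<lambda>b. b \<in> (\<lambda>A. ereal (ball_mean u x \<epsilon> A)) ` {A \<in> \<A>. loewner_le A (\<phi> \<epsilon> *\<^sub>R mat 1)}"]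
    by (simp add: I_def setcompr_eq_image image_image)
  have bounds: "\<forall>\<^sub>F \<epsilon> in at_right 0. ereal (f - e) \<le> ereal C * I \<epsilon> \<and> ereal C * I \<epsilon> \<le> ereal (f + e)" if "e > 0" for e
    using eventually_trace_inf_op_scaled_mean_bounds[OF assms(1,3,4,5,8,9) x lsc f that]
    by (simp only: CI C_def[symmetric])
  \<comment> \<open>\<open>real_of_ereal\<close> sends infinite values to 0, but
    \<open>bounds\<close> makes the scaled infimum finite for small \<epsilon>, where
    \<open>r\<close> is therefore the true difference.\<close>
  define r where "r \<epsilon> = f - real_of_ereal (ereal C * I \<epsilon>)" for \<epsilon>
  have "(r \<longlongrightarrow> 0) (at_right 0)"
  proof (rule tendstoI)
    fix e :: real assume "e > 0"
    then have "e / 2 > 0" by simp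
    from bounds[OF this] show "\<forall>\<^sub>F \<epsilon> in at_right 0. dist (r \<epsilon>) 0 < e"
    proof eventually_elim
      case (elim \<epsilon>)
      then obtain l where l: "ereal C * I \<epsilon> = ereal l" by (cases "ereal C * I \<epsilon>") auto
      then show ?case using elim \<open>e > 0\<close> by (simp add: r_def dist_real_def abs_less_iff)
    qed
  qed
  then have "r \<in> o[at_right 0](\<lambda>_. 1)" by (intro smalloI_tendsto) auto
  moreover have "\<forall>\<^sub>F \<epsilon> in at_right 0. trace_inf_op \<A> (hessian u x) = ereal C * I \<epsilon> + ereal (r \<epsilon>)"
    using bounds[OF zero_less_one]
  proof eventually_elim
    case (elim \<epsilon>)
    then obtain l where "ereal C * I \<epsilon> = ereal l" by (cases "ereal C * I \<epsilon>") auto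
    then show ?case by (simp add: r_def f)
  qed
  ultimately show "\<exists>r :: real \<Rightarrow> real. r \<in> o[at_right 0](\<lambda>_. 1) \<and>
           (\<forall>\<^sub>F \<epsilon> in at_right 0.
              trace_inf_op \<A> (hessian u x) =
                ereal (2 * (real CARD('n) + 2)) *
                  (INF A\<in>{A \<in> \<A>. loewner_le A (\<phi> \<epsilon> *\<^sub>R mat 1)}. ereal (ball_mean u x \<epsilon> A))
                + ereal (r \<epsilon>))"
    unfolding C_def I_def by blast
qed

end
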